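(* Let $F$ be a finite simple graph with maximum degree $\Delta \geq 1$, and let $G$ be a $k$-fold cover of $F$. Then $\gamma(G) \geq \frac{1}{H(\Delta)}\,k\,\gamma(F)$, where $H(\Delta) = 1 + \frac{1}{2} + \frac{1}{3} + \cdots + \frac{1}{\Delta}$.
   Context: All graphs are finite, simple and undirected. A graph $G$ is a cover of a graph $F$ if there is an onto map $\pi: V(G)\to V(F)$ such that for every vertex $v$ of $G$, $\pi$ maps the neighbours of $v$ in $G$ bijectively onto the neighbours of $\pi(v)$ in $F$; the cover is $k$-fold if every fibre $\pi^{-1}(u)$ has exactly $k$ vertices. (Degrees are preserved by $\pi$, so $G$ and $F$ have the same maximum degree $\Delta$.) $\gamma(\cdot)$ denotes the domination number: the minimum size of a set $S$ of vertices such that every vertex not in $S$ has a neighbour in $S$. *)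

theory Defs
  imports "HOL-Analysis.Analysis"
begin

definition fin_simple_graph :: "'a set \<Rightarrow> ('a \<Rightarrow> 'a \<Rightarrow> bool) \<Rightarrow> bool" where
  "fin_simple_graph V E \<longleftrightarrow> finite V \<and>
     (\<forall>u v. E u v \<longrightarrow> u \<in> V \<and> v \<in> V) \<and>
     (\<forall>u v. E u v \<longrightarrow> E v u) \<and> (\<forall>v. \<not> E v v)"

definition nbrs :: "'a set \<Rightarrow> ('a \<Rightarrow> 'a \<Rightarrow> bool) \<Rightarrow> 'a \<Rightarrow> 'a set" where
  "nbrs V E v = {u \<in> V. E v u}"

definition degree :: "'a set \<Rightarrow> ('a \<Rightarrow> 'a \<Rightarrow> bool) \<Rightarrow> 'a \<Rightarrow> nat" where
  "degree V E v = card (nbrs V E v)"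

definition max_degree :: "'a set \<Rightarrow> ('a \<Rightarrow> 'a \<Rightarrow> bool) \<Rightarrow> nat" where
  "max_degree V E = Max (insert 0 (degree V E ` V))"

definition dominating_set :: "'a set \<Rightarrow> ('a \<Rightarrow> 'a \<Rightarrow> bool) \<Rightarrow> 'a set \<Rightarrow> bool" where
  "dominating_set V E S \<longleftrightarrow> S \<subseteq> V \<and> (\<forall>v \<in> V - S. \<exists>u \<in> S. E v u)"

definition domination_number :: "'a set \<Rightarrow> ('a \<Rightarrow> 'a \<Rightarrow> bool) \<Rightarrow> nat" where
  "domination_number V E = (LEAST n. \<exists>S. dominating_set V E S \<and> card S = n)"

definition covering_map ::
  "'a set \<Rightarrow> ('a \<Rightarrow> 'a \<Rightarrow> bool) \<Rightarrow> 'b set \<Rightarrow> ('b \<Rightarrow> 'b \<Rightarrow> bool) \<Rightarrow> ('a \<Rightarrow> 'b) \<Rightarrow> bool" where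
  "covering_map VG EG VF EF p \<longleftrightarrow> p ` VG = VF \<and>
     (\<forall>v \<in> VG. bij_betw p (nbrs VG EG v) (nbrs VF EF (p v)))"

definition k_fold_cover ::
  "nat \<Rightarrow> 'a set \<Rightarrow> ('a \<Rightarrow> 'a \<Rightarrow> bool) \<Rightarrow> 'b set \<Rightarrow> ('b \<Rightarrow> 'b \<Rightarrow> bool) \<Rightarrow> bool" where
  "k_fold_cover k VG EG VF EF \<longleftrightarrow> (\<exists>p. covering_map VG EG VF EF p \<and>
     (\<forall>u \<in> VF. card {v \<in> VG. p v = u} = k))"

end

theory Submission
  imports Defs
begin

text \<open>
  The fibre densities of a minimum dominating set of \<open>G\<close> form a fractional dominating function
  \<open>w\<close> on \<open>F\<close> of total weight \<open>W = \<gamma>(G) / k\<close>, so it suffices to show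
  \<open>\<gamma>(F) \<le> H(\<Delta>) W\<close>. The greedy bound for set covers only gives \<open>H(\<Delta> + 1)\<close>, because
  closed neighbourhoods have up to \<open>\<Delta> + 1\<close> elements. The missing \<open>W / (\<Delta> + 1)\<close> is recovered
  at both ends of the greedy process.

  At the end, when every set contains at most two uncovered points, a maximum matching replaces
  a maximal one; the fractional vertex cover number is at most \<open>3/2\<close> of its size, and this
  saves \<open>W / 6\<close>. At the beginning, the packing \<open>T\<close> of closed neighbourhoods of size
  \<open>\<Delta> + 1\<close> is chosen in order of decreasing weight. A neighbour of \<open>t \<in> T\<close> loses two points
  of its closed neighbourhood, and three if it is heavier than \<open>t\<close>, so at most
  \<open>\<Delta> W - 2 |T| + 2 w(T)\<close> vertices remain. Together with
  \<open>|V| \<le> (\<Delta> + 1) W\<close> this closes the gap for \<open>\<Delta> \<ge> 3\<close>, where the two ranges of \<open>|T|\<close>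
  overlap because \<open>(\<Delta> - 3)(\<Delta> - 4) \<ge> 0\<close>. For \<open>\<Delta> \<le> 2\<close> Ore's bound
  \<open>\<gamma> \<le> |V| / 2\<close> (without isolated vertices) is enough.
\<close>

section \<open>Fractional covers\<close>

text \<open>Weak linear programming duality, by double counting the incidences
  \<open>u \<in> A i\<close>. A nonconstant \<open>y\<close> is needed where a matching supplies the
  dual weights.\<close>

lemma sum_le_fractional_cover:
  fixes w :: "'i \<Rightarrow> real" and y :: "'a \<Rightarrow> real"
  assumes "finite I" "finite U"
    and cov: "\<And>u. u \<in> U \<Longrightarrow> 1 \<le> sum w {i\<in>I. u \<in> A i}"
    and y: "\<And>u. u \<in> U \<Longrightarrow> 0 \<le> y u"
  shows "sum y U \<le> (\<Sum>i\<in>I. w i * sum y (A i \<inter> U))"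
proof -
  have "sum y U \<le> (\<Sum>u\<in>U. y u * sum w {i\<in>I. u \<in> A i})"
    by (rule sum_mono) (use cov y mult_left_mono[of 1] in fastforce)
  also have "\<dots> = (\<Sum>u\<in>U. \<Sum>i\<in>I. if u \<in> A i then y u * w i else 0)"
    using assms(1) by (auto simp: sum_distrib_left sum.inter_filter intro!: sum.cong)
  also have "\<dots> = (\<Sum>i\<in>I. \<Sum>u\<in>U. if u \<in> A i then y u * w i else 0)"
    by (rule sum.swap)
  also have "\<dots> = (\<Sum>i\<in>I. w i * sum y (A i \<inter> U))"
  proof (rule sum.cong[OF refl])
    fix i
    have "A i \<inter> U = {u\<in>U. u \<in> A i}" by auto
    then show "(\<Sum>u\<in>U. if u \<in> A i then y u * w i else 0) = w i * sum y (A i \<inter> U)"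
      using assms(2) by (simp add: sum.inter_filter sum_distrib_left mult.commute if_distrib cong: if_cong)
  qed
  finally show ?thesis .
qed

lemma card_le_fractional_cover:
  fixes w :: "'i \<Rightarrow> real"
  assumes "finite I" "finite U"
    and "\<And>u. u \<in> U \<Longrightarrow> 1 \<le> sum w {i\<in>I. u \<in> A i}"
  shows "real (card U) \<le> (\<Sum>i\<in>I. w i * real (card (A i \<inter> U)))"
  using sum_le_fractional_cover[of I U w A "\<lambda>_. 1"] assms by simp

section \<open>Maximum matchings and fractional vertex covers\<close>

definition matching_in :: "'a set set \<Rightarrow> 'a set set \<Rightarrow> bool" where
  "matching_in E M \<longleftrightarrow> M \<subseteq> E \<and> disjoint M"

text \<open>There is no augmenting path of length three, so the unmatched vertices adjacent to a matched
  edge either see only one of its ends or are a single vertex. The point \<open>r\<close> receives the third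
  half unit of the edge in a fractional vertex cover.\<close>

lemma maximum_matching_anchor:
  assumes fin: "finite E" and E: "\<And>e. e \<in> E \<Longrightarrow> card e = 2"
    and M: "matching_in E M" and max: "\<And>M'. matching_in E M' \<Longrightarrow> card M' \<le> card M"
    and e: "e \<in> M"
  shows "\<exists>r. \<forall>x v. x \<notin> \<Union>M \<longrightarrow> v \<in> e \<longrightarrow> {x, v} \<in> E \<longrightarrow> r = x \<or> r = v"
proof -
  have ME: "M \<subseteq> E" and dis: "disjoint M" using M by (auto simp: matching_in_def)
  have "card e = 2" using e ME E by auto
  then obtain a b where ab: "e = {a, b}" "a \<noteq> b" by (auto simp: card_2_iff)
  have aug: "x = x'"
    if x: "x \<notin> \<Union>M" "{x, a} \<in> E" and x': "x' \<notin> \<Union>M" "{x', b} \<in> E" for x x'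
  proof (rule ccontr)
    assume ne: "x \<noteq> x'"
    \<comment> \<open>Augmentation along the path \<open>x\<close>, \<open>a\<close>,
      \<open>b\<close>, \<open>x'\<close>: the middle edge \<open>e\<close> is traded for the two
      outer edges.\<close>
    define M' where "M' = insert {x, a} (insert {x', b} (M - {e}))"
    have xn: "x \<noteq> a" "x \<noteq> b" "x' \<noteq> a" "x' \<noteq> b" using x x' e ab by auto
    have d: "f \<inter> e = {}" if "f \<in> M - {e}" for f
      using dis that e by (auto simp: disjoint_def pairwise_def disjnt_def)
    have "disjoint M'"
      unfolding M'_def pairwise_insert
      using dis d x(1) x'(1) ne xn ab
      by (auto simp: disjnt_def pairwise_def)
    moreover have "M' \<subseteq> E" using ME x x' by (auto simp: M'_def)
    ultimately have "card M' \<le> card M" by (intro max) (simp add: matching_in_def)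
    moreover have "finite M" using fin ME finite_subset by blast
    moreover have "{x, a} \<notin> insert {x', b} (M - {e})" "{x', b} \<notin> M - {e}"
      using x x' ne xn by (auto simp: doubleton_eq_iff)
    ultimately show False using e card_Suc_Diff1[of M e] by (auto simp: M'_def)
  qed
  show ?thesis
  proof (cases "\<exists>x. x \<notin> \<Union>M \<and> {x, a} \<in> E")
    case False
    \<comment> \<open>Only \<open>b\<close> can see unmatched vertices, so it serves as the
      anchor.\<close>
    then show ?thesis using ab by (intro exI[of _ b]) auto
  next
    case True
    then obtain x where x: "x \<notin> \<Union>M" "{x, a} \<in> E" by auto
    show ?thesis
    proof (cases "\<exists>x. x \<notin> \<Union>M \<and> {x, b} \<in> E")
      case False
      then show ?thesis using ab by (intro exI[of _ a]) auto
    next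
      case True
      then obtain x' where "x' \<notin> \<Union>M" "{x', b} \<in> E" by auto
      then have "x'' = x" if "x'' \<notin> \<Union>M" "v \<in> e" "{x'', v} \<in> E" for x'' v
        using aug[of x x'] aug[of x'' x'] aug[of x x''] x that ab by auto
      then show ?thesis by (intro exI[of _ x]) blast
    qed
  qed
qed

text \<open>Each edge of \<open>M\<close> gives 1/2 to both of its ends and 1/2 to its anchor. An
  edge between matched vertices collects 1/2 twice. If one end is unmatched, the choice of anchor
  brings the total to 1 as well. Maximality excludes edges between two unmatched vertices.\<close>

lemma fractional_vertex_cover_matching:
  assumes fin: "finite E" and E: "\<And>e. e \<in> E \<Longrightarrow> card e = 2"
    and U: "finite U"
    and M: "matching_in E M" and max: "\<And>M'. matching_in E M' \<Longrightarrow> card M' \<le> card M"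
  obtains z :: "'a \<Rightarrow> real"
  where "\<And>v. 0 \<le> z v" "\<And>u v. {u, v} \<in> E \<Longrightarrow> 1 \<le> z u + z v"
    "sum z U \<le> 3 / 2 * card M"
proof -
  have ME: "M \<subseteq> E" using M by (auto simp: matching_in_def)
  have finM: "finite M" using fin ME finite_subset by blast
  have "\<forall>e\<in>M. \<exists>r. \<forall>x v. x \<notin> \<Union>M \<longrightarrow> v \<in> e \<longrightarrow> {x, v} \<in> E \<longrightarrow> r = x \<or> r = v"
    using maximum_matching_anchor[OF fin E M max] by blast
  then obtain r where
    r: "\<And>e x v. e \<in> M \<Longrightarrow> x \<notin> \<Union>M \<Longrightarrow> v \<in> e \<Longrightarrow> {x, v} \<in> E \<Longrightarrow> r e = x \<or> r e = v"
    by metis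
  define g :: "'a set \<Rightarrow> 'a \<Rightarrow> real" where
    "g e v = of_bool (v \<in> e) / 2 + of_bool (v = r e) / 2" for e v
  define z where "z v = (\<Sum>e\<in>M. g e v)" for v
  have g0: "0 \<le> g e v" for e v by (simp add: g_def)
  have ge: "g e v \<le> z v" if "e \<in> M" for e v
    unfolding z_def using that finM g0 by (intro member_le_sum) auto
  have half: "1 / 2 \<le> z v" if "v \<in> \<Union>M" for v
  proof -
    from that obtain e where e: "e \<in> M" "v \<in> e" by blast
    have "1 / 2 \<le> g e v" using e(2) by (simp add: g_def)
    then show ?thesis using ge[OF e(1), of v] by linarith
  qed
  have unm: "1 \<le> z x + z v" if xv: "{x, v} \<in> E" "x \<notin> \<Union>M" "v \<in> \<Union>M" for x v
  proof -
    from xv(3) obtain e where e: "e \<in> M" "v \<in> e" by blast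
    from r[OF e(1) xv(2) e(2) xv(1)] have "1 \<le> g e x + g e v"
      using e(2) by (auto simp: g_def)
    then show ?thesis using ge[OF e(1), of x] ge[OF e(1), of v] by linarith
  qed
  have cov: "1 \<le> z u + z v" if uv: "{u, v} \<in> E" for u v
  proof -
    have "u \<in> \<Union>M \<or> v \<in> \<Union>M"
    proof (rule ccontr)
      assume n: "\<not> ?thesis"
      then have "matching_in E (insert {u, v} M)"
        using M uv by (auto simp: matching_in_def pairwise_insert disjnt_def)
      moreover have "{u, v} \<notin> M" using n by auto
      ultimately show False using max[of "insert {u, v} M"] finM by simp
    qed
    moreover have "{v, u} \<in> E" using uv by (simp add: insert_commute)
    ultimately show ?thesis
      using unm[of u v] unm[of v u] half[of u] half[of v] uv by linarith
  qed
  have "sum z U = (\<Sum>e\<in>M. \<Sum>v\<in>U. g e v)"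
    unfolding z_def by (rule sum.swap)
  also have "\<dots> \<le> (\<Sum>e\<in>M. 3 / 2)"
  proof (rule sum_mono)
    fix e assume "e \<in> M"
    then have "card e = 2" using ME E by auto
    then have fe: "finite e" using card.infinite by fastforce
    have "(\<Sum>v\<in>U. g e v) = card (U \<inter> e) / 2 + card (U \<inter> {r e}) / 2"
      using U by (simp add: g_def sum.distrib sum_divide_distrib[symmetric] Int_def del: Int_insert_right)
    moreover have "card (U \<inter> e) \<le> 2" using card_mono[OF fe, of "U \<inter> e"] \<open>card e = 2\<close> by simp
    moreover have "card (U \<inter> {r e}) \<le> 1" using card_mono[of "{r e}" "U \<inter> {r e}"] by simp
    ultimately show "(\<Sum>v\<in>U. g e v) \<le> 3 / 2" by simp
  qed
  finally have "sum z U \<le> 3 / 2 * card M" by simp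
  then show thesis using that[of z] cov g0 by (simp add: z_def sum_nonneg)
qed

text \<open>The matching endgame. One set per edge of \<open>M\<close> and one per unmatched point
  give \<open>card S \<le> card U - card M\<close>, while weak duality with the truncation of
  \<open>1 - z\<close> gives \<open>card U - 3 / 2 * card M \<le> sum w I\<close>. Eliminating
  \<open>card M\<close> yields the bound.\<close>

lemma set_cover_pairs:
  fixes w :: "'i \<Rightarrow> real"
  assumes I: "finite I" and U: "finite U"
    and w: "\<And>i. i \<in> I \<Longrightarrow> 0 \<le> w i"
    and cov: "\<And>u. u \<in> U \<Longrightarrow> 1 \<le> sum w {i\<in>I. u \<in> A i}"
    and two: "\<And>i. i \<in> I \<Longrightarrow> card (A i \<inter> U) \<le> 2"
  shows "\<exists>S\<subseteq>I. U \<subseteq> \<Union>(A ` S) \<and> 3 * real (card S) \<le> real (card U) + 2 * sum w I"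
proof -
  define E where "E = {A i \<inter> U | i. i \<in> I \<and> card (A i \<inter> U) = 2}"
  have fE: "finite E" using I by (simp add: E_def)
  have E2: "card e = 2" if "e \<in> E" for e using that by (auto simp: E_def)
  have "matching_in E {}" by (simp add: matching_in_def)
  moreover have "\<forall>M'. matching_in E M' \<longrightarrow> card M' < Suc (card E)"
    using fE by (auto simp: matching_in_def less_Suc_eq_le intro: card_mono)
  ultimately have "\<exists>M. matching_in E M \<and> (\<forall>M'. matching_in E M' \<longrightarrow> card M' \<le> card M)"
    by (rule ex_has_greatest_nat)
  then obtain M where M: "matching_in E M"
    and max: "\<And>M'. matching_in E M' \<Longrightarrow> card M' \<le> card M" by auto
  have ME: "M \<subseteq> E" and dis: "disjoint M" using M by (auto simp: matching_in_def)
  have finM: "finite M" using fE ME finite_subset by blast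
  have MU: "\<Union>M \<subseteq> U" using ME by (auto simp: E_def)
  have "\<forall>e\<in>M. \<exists>i. i \<in> I \<and> e = A i \<inter> U" using ME by (auto simp: E_def)
  then obtain f where f: "\<And>e. e \<in> M \<Longrightarrow> f e \<in> I \<and> e = A (f e) \<inter> U" by metis
  have "\<exists>i. i \<in> I \<and> u \<in> A i" if "u \<in> U" for u
  proof (rule ccontr)
    assume "\<not> ?thesis"
    then have empty: "{i\<in>I. u \<in> A i} = {}" by auto
    show False using cov[OF that] unfolding empty by simp
  qed
  then obtain h where h: "\<And>u. u \<in> U \<Longrightarrow> h u \<in> I \<and> u \<in> A (h u)" by metis
  define S where "S = f ` M \<union> h ` (U - \<Union>M)"
  have SI: "S \<subseteq> I" using f h by (auto simp: S_def)
  have SU: "U \<subseteq> \<Union>(A ` S)"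
  proof
    fix u assume u: "u \<in> U"
    show "u \<in> \<Union>(A ` S)"
    proof (cases "u \<in> \<Union>M")
      case True
      then obtain e where "e \<in> M" "u \<in> e" by blast
      then show ?thesis using f[of e] by (auto simp: S_def)
    next
      case False
      then show ?thesis using u h[of u] by (auto simp: S_def)
    qed
  qed
  have "card (\<Union>M) = 2 * card M"
  proof -
    have "card (\<Union>M) = sum card M"
    proof (rule card_Union_disjoint[OF dis])
      show "finite e" if "e \<in> M" for e
        using that MU by (intro finite_subset[OF _ U]) blast
    qed
    also have "\<dots> = (\<Sum>e\<in>M. 2)" using E2 ME by (intro sum.cong) auto
    finally show ?thesis by simp
  qed
  then have cM: "card (U - \<Union>M) + 2 * card M = card U"
    using card_Diff_subset[OF finite_subset[OF MU U] MU] card_mono[OF U MU] by simp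
  have "card S \<le> card M + card (U - \<Union>M)"
    unfolding S_def using card_image_le[OF finM, of f] card_image_le[of "U - \<Union>M" h] U
      card_Un_le[of "f ` M" "h ` (U - \<Union>M)"] by fastforce
  with cM have cS: "real (card S) \<le> real (card U) - real (card M)" by linarith
  obtain z :: "'a \<Rightarrow> real" where z0: "\<And>v. 0 \<le> z v"
    and z1: "\<And>u v. {u, v} \<in> E \<Longrightarrow> 1 \<le> z u + z v"
    and zs: "sum z U \<le> 3 / 2 * card M"
    using fractional_vertex_cover_matching[OF fE E2 U M max] by blast
  \<comment> \<open>Truncation keeps \<open>y\<close> nonnegative where \<open>z\<close> exceeds 1.
    Since \<open>z\<close> is nonnegative, an edge of \<open>E\<close> still carries total weight at
    most 1.\<close>
  define y where "y v = max 0 (1 - z v)" for v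
  have "real (card U) - sum z U = (\<Sum>v\<in>U. 1 - z v)" by (simp add: sum_subtractf)
  also have "\<dots> \<le> sum y U" by (rule sum_mono) (simp add: y_def)
  also have "\<dots> \<le> (\<Sum>i\<in>I. w i * sum y (A i \<inter> U))"
    by (rule sum_le_fractional_cover[OF I U cov]) (simp_all add: y_def)
  also have "\<dots> \<le> (\<Sum>i\<in>I. w i * 1)"
  proof (intro sum_mono mult_left_mono w)
    fix i assume i: "i \<in> I"
    have y1: "y v \<le> 1" for v using z0[of v] by (simp add: y_def)
    consider "card (A i \<inter> U) = 0" | "card (A i \<inter> U) = 1" | "card (A i \<inter> U) = 2"
      using two[OF i] by linarith
    then show "sum y (A i \<inter> U) \<le> 1"
    proof cases
      case 1
      then show ?thesis using U by simp
    next
      case 2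
      then obtain v where "A i \<inter> U = {v}" by (auto simp: card_1_singleton_iff)
      then show ?thesis using y1 by simp
    next
      case 3
      then obtain u v where uv: "A i \<inter> U = {u, v}" "u \<noteq> v" by (auto simp: card_2_iff)
      have "{u, v} \<in> E" using 3 i uv(1) unfolding E_def by (metis (mono_tags, lifting) mem_Collect_eq)
      then show ?thesis using uv z1[of u v] z0[of u] z0[of v] by (simp add: y_def max_def)
    qed
  qed
  finally have "real (card U) - 3 / 2 * card M \<le> sum w I" using zs by simp
  with cS have "3 * real (card S) \<le> real (card U) + 2 * sum w I" by linarith
  then show ?thesis using SI SU by blast
qed

section \<open>Greedy set covers with harmonic bounds\<close>

text \<open>One greedy phase: while some set contains \<open>Suc j\<close> uncovered points, it is
  taken, and the points it removes pay for it. The hypothesis \<open>small\<close> ranges over all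
  subsets because what the phase leaves uncovered is not known in advance.\<close>

lemma set_cover_step:
  fixes c :: real
  assumes I: "finite I" and "finite U"
    and small: "\<And>U'. U' \<subseteq> U \<Longrightarrow> (\<And>i. i \<in> I \<Longrightarrow> card (A i \<inter> U') \<le> j) \<Longrightarrow>
      \<exists>S\<subseteq>I. U' \<subseteq> \<Union>(A ` S) \<and> real (card S) \<le> real (card U') / real (Suc j) + c"
    and "\<And>i. i \<in> I \<Longrightarrow> card (A i \<inter> U) \<le> Suc j"
  shows "\<exists>S\<subseteq>I. U \<subseteq> \<Union>(A ` S) \<and> real (card S) \<le> real (card U) / real (Suc j) + c"
  using assms(2-)
proof (induction "card U" arbitrary: U rule: less_induct)
  case less
  show ?case
  proof (cases "\<exists>i\<in>I. card (A i \<inter> U) = Suc j")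
    case True
    then obtain i where i: "i \<in> I" "card (A i \<inter> U) = Suc j" by blast
    have cU: "card (U - A i) + Suc j = card U"
      using i(2) less.prems(1) card_Diff_subset_Int[of U "A i"] card_mono[of U "A i \<inter> U"]
      by (simp add: Int_commute)
    have "\<exists>S\<subseteq>I. U - A i \<subseteq> \<Union>(A ` S) \<and>
      real (card S) \<le> real (card (U - A i)) / real (Suc j) + c"
    proof (rule less.hyps)
      show "card (A i' \<inter> (U - A i)) \<le> Suc j" if "i' \<in> I" for i'
        using less.prems(3)[OF that] card_mono[of "A i' \<inter> U" "A i' \<inter> (U - A i)"] less.prems(1)
        by fastforce
      show "\<exists>S\<subseteq>I. U' \<subseteq> \<Union>(A ` S) \<and> real (card S) \<le> real (card U') / real (Suc j) + c"
        if "U' \<subseteq> U - A i" "\<And>i. i \<in> I \<Longrightarrow> card (A i \<inter> U') \<le> j" for U'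
        using less.prems(2)[of U'] that by blast
    qed (use cU less.prems(1) in auto)
    then obtain S where S: "S \<subseteq> I" "U - A i \<subseteq> \<Union>(A ` S)"
      "real (card S) \<le> real (card (U - A i)) / real (Suc j) + c"
      by blast
    have "real (card (insert i S)) \<le> 1 + real (card S)"
      using card_insert_if[OF finite_subset[OF S(1) I]] by auto
    moreover have "real (card U) / real (Suc j) = real (card (U - A i)) / real (Suc j) + 1"
      unfolding cU[symmetric] of_nat_add by (simp only: add_divide_distrib) simp
    ultimately show ?thesis
      using S i by (intro exI[of _ "insert i S"]) auto
  next
    case False
    then have "card (A i \<inter> U) \<le> j" if "i \<in> I" for i
      using less.prems(3)[OF that] that by (metis le_SucE)
    then show ?thesis using less.prems(2) by blast
  qed
qed

text \<open>Greedy phases for \<open>j\<close> down to 3, followed by the matching endgame. Plain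
  greedy would have the coefficient \<open>harm j - 1\<close>; the endgame saves the further
  1/6.\<close>

lemma set_cover_harm:
  fixes w :: "'i \<Rightarrow> real"
  assumes I: "finite I" and w: "\<And>i. i \<in> I \<Longrightarrow> 0 \<le> w i" and j: "3 \<le> j"
    and "finite U"
    and "\<And>u. u \<in> U \<Longrightarrow> 1 \<le> sum w {i\<in>I. u \<in> A i}"
    and "\<And>i. i \<in> I \<Longrightarrow> card (A i \<inter> U) \<le> j"
  shows "\<exists>S\<subseteq>I. U \<subseteq> \<Union>(A ` S) \<and>
    real (card S) \<le> real (card U) / real j + (harm j - 7 / 6) * sum w I"
  using j assms(4-)
proof (induction j arbitrary: U rule: nat_induct_at_least)
  case base
  \<comment> \<open>This fixes the constant 7/6: \<open>set_cover_pairs\<close> gives the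
    coefficient 2/3, and \<open>harm 3\<close> is 11/6.\<close>
  have h3: "harm 3 - 7 / 6 = (2 / 3 :: real)" by (simp add: harm_def numeral_3_eq_3)
  have "\<exists>S\<subseteq>I. U \<subseteq> \<Union>(A ` S) \<and>
    real (card S) \<le> real (card U) / real (Suc 2) + 2 / 3 * sum w I"
  proof (rule set_cover_step[OF I base.prems(1)])
    fix U' assume U': "U' \<subseteq> U" "\<And>i. i \<in> I \<Longrightarrow> card (A i \<inter> U') \<le> 2"
    have "finite U'" using U'(1) base.prems(1) by (rule finite_subset)
    moreover have "1 \<le> sum w {i\<in>I. u \<in> A i}" if "u \<in> U'" for u
      using that U'(1) base.prems(2) by auto
    ultimately obtain S where "S \<subseteq> I" "U' \<subseteq> \<Union>(A ` S)"
      "3 * real (card S) \<le> real (card U') + 2 * sum w I"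
      using set_cover_pairs[where w = w and A = A, OF I _ w _ U'(2)] by auto
    then show "\<exists>S\<subseteq>I. U' \<subseteq> \<Union>(A ` S) \<and>
      real (card S) \<le> real (card U') / real (Suc 2) + 2 / 3 * sum w I"
      by (intro exI[of _ S]) (auto simp: field_simps)
  qed (use base.prems(3) in simp)
  then show ?case unfolding h3 by simp
next
  case (Suc j)
  show ?case
  proof (rule set_cover_step[OF I Suc.prems(1)])
    fix U' assume U': "U' \<subseteq> U" and le: "\<And>i. i \<in> I \<Longrightarrow> card (A i \<inter> U') \<le> j"
    have fU': "finite U'" using U' Suc.prems(1) finite_subset by blast
    have cov: "1 \<le> sum w {i\<in>I. u \<in> A i}" if "u \<in> U'" for u
      using that U' Suc.prems(2) by blast
    from Suc.IH[OF fU' cov le]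
    obtain S where S: "S \<subseteq> I" "U' \<subseteq> \<Union>(A ` S)"
      "real (card S) \<le> real (card U') / real j + (harm j - 7 / 6) * sum w I" by auto
    \<comment> \<open>At most \<open>j * sum w I\<close> points are left, so replacing the
      denominator \<open>j\<close> by \<open>Suc j\<close> costs at most
      \<open>sum w I / Suc j\<close>, which is the new harmonic term.\<close>
    have "real (card U') \<le> (\<Sum>i\<in>I. w i * real (card (A i \<inter> U')))"
      by (rule card_le_fractional_cover[OF I fU' cov])
    also have "\<dots> \<le> (\<Sum>i\<in>I. w i * real j)"
      using le w by (intro sum_mono mult_left_mono) auto
    also have "\<dots> = real j * sum w I" by (simp add: sum_distrib_left mult.commute)
    finally have c: "real (card U') \<le> real j * sum w I" .
    have j0: "0 < real j" using \<open>3 \<le> j\<close> by simp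
    have "real (card U') / real j - real (card U') / real (Suc j)
        = real (card U') / (real j * real (Suc j))"
      using j0 by (simp add: field_simps)
    also have "\<dots> \<le> real j * sum w I / (real j * real (Suc j))"
      using c j0 by (intro divide_right_mono) auto
    also have "\<dots> = sum w I / real (Suc j)" using j0 by simp
    finally have step: "real (card U') / real j - real (card U') / real (Suc j)
        \<le> sum w I / real (Suc j)" .
    have "real (card U') / real j + (harm j - 7 / 6) * sum w I
        \<le> real (card U') / real (Suc j) + (harm (Suc j) - 7 / 6) * sum w I"
    proof -
      have harm1: "harm (Suc j) - 7 / 6 = harm j - 7 / 6 + 1 / real (Suc j)"
        by (simp add: harm_Suc inverse_eq_divide)
      have "(harm (Suc j) - 7 / 6) * sum w I = (harm j - 7 / 6) * sum w I + sum w I / real (Suc j)"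
        unfolding harm1 by (simp only: distrib_right times_divide_eq_left mult_1)
      then show ?thesis using step by linarith
    qed
    with S show "\<exists>S\<subseteq>I. U' \<subseteq> \<Union>(A ` S) \<and>
      real (card S) \<le> real (card U') / real (Suc j) + (harm (Suc j) - 7 / 6) * sum w I"
      by (intro exI[of _ S]) auto
  qed (use Suc.prems(3) in simp)
qed

section \<open>Domination\<close>

definition closed_nbhd :: "'a set \<Rightarrow> ('a \<Rightarrow> 'a \<Rightarrow> bool) \<Rightarrow> 'a \<Rightarrow> 'a set" where
  "closed_nbhd V E v = insert v (nbrs V E v)"

definition fractional_dominating :: "'a set \<Rightarrow> ('a \<Rightarrow> 'a \<Rightarrow> bool) \<Rightarrow> ('a \<Rightarrow> real) \<Rightarrow> bool" where
  "fractional_dominating V E w \<longleftrightarrow>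
     (\<forall>v\<in>V. 0 \<le> w v) \<and> (\<forall>v\<in>V. 1 \<le> sum w (closed_nbhd V E v))"

lemma closed_nbhd_self [simp]: "v \<in> closed_nbhd V E v"
  by (simp add: closed_nbhd_def)

lemma closed_nbhd_subset: "v \<in> V \<Longrightarrow> closed_nbhd V E v \<subseteq> V"
  by (auto simp: closed_nbhd_def nbrs_def)

lemma closed_nbhd_sym:
  assumes "fin_simple_graph V E" "u \<in> closed_nbhd V E v"
  shows "v \<in> closed_nbhd V E u"
  using assms by (auto simp: closed_nbhd_def nbrs_def fin_simple_graph_def)

text \<open>By this symmetry a fractional dominating function is a fractional cover by closed
  neighbourhoods, so the cover lemmas apply.\<close>

lemma closed_nbhd_converse:
  assumes "fin_simple_graph V E" "v \<in> V"
  shows "{u\<in>V. v \<in> closed_nbhd V E u} = closed_nbhd V E v"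
  using assms closed_nbhd_sym closed_nbhd_subset by fast

lemma finite_closed_nbhd: "finite V \<Longrightarrow> finite (closed_nbhd V E v)"
  by (simp add: closed_nbhd_def nbrs_def)

lemma card_closed_nbhd:
  assumes "fin_simple_graph V E"
  shows "card (closed_nbhd V E v) = Suc (degree V E v)"
  using assms by (simp add: closed_nbhd_def degree_def nbrs_def fin_simple_graph_def)

lemma degree_le_max_degree:
  assumes "finite V" "v \<in> V"
  shows "degree V E v \<le> max_degree V E"
  unfolding max_degree_def using assms by (intro Max_ge) auto

lemma dominating_set_iff_closed_nbhd:
  assumes "fin_simple_graph V E"
  shows "dominating_set V E S \<longleftrightarrow> S \<subseteq> V \<and> V \<subseteq> \<Union>(closed_nbhd V E ` S)"
proof -
  have sym: "E u v \<longleftrightarrow> E v u" for u v using assms by (auto simp: fin_simple_graph_def)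
  have "v \<in> \<Union>(closed_nbhd V E ` S) \<longleftrightarrow> v \<in> S \<or> (\<exists>u\<in>S. E v u)" if "v \<in> V" for v
    using that sym[of v] by (auto simp: closed_nbhd_def nbrs_def)
  then show ?thesis unfolding dominating_set_def subset_iff[of V] by blast
qed

lemma domination_number_le: "dominating_set V E S \<Longrightarrow> domination_number V E \<le> card S"
  unfolding domination_number_def by (rule Least_le) blast

lemma domination_number_attained:
  obtains S where "dominating_set V E S" "card S = domination_number V E"
proof -
  have "dominating_set V E V" by (simp add: dominating_set_def)
  then have "\<exists>n S. dominating_set V E S \<and> card S = n" by blast
  from LeastI_ex[OF this] show thesis
    using that unfolding domination_number_def[symmetric] by blast
qed

lemma card_le_fractional_dominating:
  assumes G: "fin_simple_graph V E" and w: "fractional_dominating V E w" and U: "U \<subseteq> V"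
  shows "real (card U) \<le> (\<Sum>u\<in>V. w u * real (card (closed_nbhd V E u \<inter> U)))"
proof -
  have "finite V" using G by (simp add: fin_simple_graph_def)
  then show ?thesis
    using w U closed_nbhd_converse[OF G] finite_subset[OF U]
    by (intro card_le_fractional_cover) (auto simp: fractional_dominating_def subset_iff)
qed

section \<open>Ore's bound and maximum degree at most two\<close>

text \<open>Ore's argument: the complement of a minimum dominating set, together with the isolated
  vertices, is dominating too.\<close>

lemma double_domination_number_le:
  assumes G: "fin_simple_graph V E"
  shows "2 * domination_number V E \<le> card V + card {v\<in>V. nbrs V E v = {}}"
proof -
  define Z where "Z = {v\<in>V. nbrs V E v = {}}"
  have V: "finite V" and sym: "\<And>u v. E u v \<Longrightarrow> E v u" and irr: "\<And>v. \<not> E v v"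
    using G by (auto simp: fin_simple_graph_def)
  obtain S where S: "dominating_set V E S" and cS: "card S = domination_number V E"
    by (rule domination_number_attained)
  have SV: "S \<subseteq> V" using S by (simp add: dominating_set_def)
  have fS: "finite S" using SV V finite_subset by blast
  have "\<exists>u\<in>V - S. E v u" if v: "v \<in> S" "v \<notin> Z" for v
  proof (rule ccontr)
    assume n: "\<not> ?thesis"
    obtain x where x: "E v x" "x \<in> V" using v SV by (auto simp: Z_def nbrs_def)
    have "x \<in> S" "x \<noteq> v" using n x irr by auto
    \<comment> \<open>All neighbours of \<open>v\<close> lie in \<open>S\<close>, so
      \<open>v\<close> dominates nothing outside \<open>S\<close> and is itself dominated by
      \<open>x\<close>. Dropping it contradicts minimality.\<close>
    have "dominating_set V E (S - {v})"
      unfolding dominating_set_def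
    proof (intro conjI ballI)
      fix u assume u: "u \<in> V - (S - {v})"
      show "\<exists>y\<in>S - {v}. E u y"
      proof (cases "u = v")
        case True
        then show ?thesis using x \<open>x \<in> S\<close> \<open>x \<noteq> v\<close> by auto
      next
        case False
        then obtain y where "y \<in> S" "E u y" using S u by (auto simp: dominating_set_def)
        moreover have "y \<noteq> v" using \<open>E u y\<close> sym n u False by auto
        ultimately show ?thesis by auto
      qed
    qed (use SV in auto)
    then have "domination_number V E \<le> card (S - {v})" by (rule domination_number_le)
    then show False using cS v fS card_Diff1_less[of S v] by simp
  qed
  then have "dominating_set V E ((V - S) \<union> Z)"
    unfolding dominating_set_def by (auto simp: Z_def)
  then have "domination_number V E \<le> card ((V - S) \<union> Z)" by (rule domination_number_le)
  also have "\<dots> \<le> card (V - S) + card Z" by (rule card_Un_le)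
  also have "card (V - S) = card V - card S" using SV fS by (simp add: card_Diff_subset)
  finally show ?thesis using cS card_mono[OF V SV] unfolding Z_def by linarith
qed

text \<open>Half of the maximum degree plus one is the harmonic number exactly for degrees 1 and 2.
  An isolated vertex has weight at least 1 and covers only itself; what is saved in the count of
  \<open>V\<close> pays for its extra unit in Ore's bound.\<close>

lemma domination_number_le_small_degree:
  assumes G: "fin_simple_graph V E" and w: "fractional_dominating V E w"
    and D: "1 \<le> max_degree V E"
  shows "2 * real (domination_number V E) \<le> (real (max_degree V E) + 1) * sum w V"
proof -
  define Z where "Z = {v\<in>V. nbrs V E v = {}}"
  define D where "D = max_degree V E"
  have V: "finite V" using G by (simp add: fin_simple_graph_def)
  have w0: "0 \<le> w v" and w1: "1 \<le> sum w (closed_nbhd V E v)" if "v \<in> V" for v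
    using w that by (auto simp: fractional_dominating_def)
  have "real (card V) \<le> (\<Sum>u\<in>V. w u * real (card (closed_nbhd V E u \<inter> V)))"
    by (rule card_le_fractional_dominating[OF G w]) simp
  also have "\<dots> \<le> (\<Sum>u\<in>V. w u * (real D + 1) - (if u \<in> Z then real D * w u else 0))"
  proof (rule sum_mono)
    fix u assume u: "u \<in> V"
    have *: "closed_nbhd V E u \<inter> V = closed_nbhd V E u" using closed_nbhd_subset[OF u] by auto
    show "w u * real (card (closed_nbhd V E u \<inter> V))
      \<le> w u * (real D + 1) - (if u \<in> Z then real D * w u else 0)"
    proof (cases "u \<in> Z")
      case True
      then show ?thesis by (simp add: * Z_def closed_nbhd_def algebra_simps)
    next
      case False
      have "real (card (closed_nbhd V E u)) \<le> real D + 1"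
        using card_closed_nbhd[OF G, of u] degree_le_max_degree[OF V u, of E] by (simp add: D_def)
      then show ?thesis unfolding * using False w0[OF u] by (simp add: mult_left_mono)
    qed
  qed
  also have "\<dots> = (real D + 1) * sum w V - real D * sum w Z"
  proof -
    have "(\<Sum>u\<in>V. if u \<in> Z then real D * w u else 0) = (\<Sum>u\<in>Z. real D * w u)"
      using V by (simp add: Z_def sum.inter_filter)
    then show ?thesis
      by (simp add: sum_subtractf sum_distrib_left[symmetric] sum_distrib_right[symmetric] mult.commute)
  qed
  finally have "real (card V) + real D * sum w Z \<le> (real D + 1) * sum w V" by simp
  moreover have "real (card Z) \<le> sum w Z"
  proof -
    have "(\<Sum>v\<in>Z. 1) \<le> sum w Z"
      by (rule sum_mono) (use w1 in \<open>fastforce simp: Z_def closed_nbhd_def\<close>)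
    then show ?thesis by simp
  qed
  then have "real (card Z) \<le> real D * sum w Z"
    using D mult_mono[of 1 "real D" "real (card Z)" "sum w Z"] by (simp add: D_def)
  moreover have "2 * real (domination_number V E) \<le> real (card V) + real (card Z)"
    using double_domination_number_le[OF G] unfolding Z_def by linarith
  ultimately show ?thesis by (simp add: D_def)
qed

section \<open>Greedy packings and maximum degree at least three\<close>

text \<open>A heaviest element is taken, everything meeting it is discarded, and this is repeated: a
  discarded element meets a chosen one that is at least as heavy. Nonemptiness lets a chosen element
  meet itself.\<close>

lemma greedy_packing:
  fixes w :: "'i \<Rightarrow> real"
  assumes "finite A" "\<And>a. a \<in> A \<Longrightarrow> N a \<noteq> {}"
  shows "\<exists>T\<subseteq>A. disjoint_family_on N T \<and> (\<forall>u\<in>A. \<exists>t\<in>T. w u \<le> w t \<and> N u \<inter> N t \<noteq> {})"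
  using assms
proof (induction "card A" arbitrary: A rule: less_induct)
  case less
  show ?case
  proof (cases "A = {}")
    case False
    then have ne: "finite (w ` A)" "w ` A \<noteq> {}" using less.prems(1) by auto
    then obtain m where m: "m \<in> A" "w m = Max (w ` A)" using Max_in[OF ne] by (metis imageE)
    have max: "w u \<le> w m" if "u \<in> A" for u using m ne that by simp
    define B where "B = {u\<in>A. N u \<inter> N m = {}}"
    have "m \<notin> B" using less.prems(2)[OF m(1)] by (auto simp: B_def)
    then have "B \<subset> A" using m by (auto simp: B_def)
    then have "card B < card A" using less.prems(1) by (simp add: psubset_card_mono)
    from less.hyps[OF this] obtain T where T: "T \<subseteq> B" "disjoint_family_on N T"
      "\<forall>u\<in>B. \<exists>t\<in>T. w u \<le> w t \<and> N u \<inter> N t \<noteq> {}"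
      using less.prems \<open>B \<subset> A\<close> finite_subset by blast
    have "disjoint_family_on N (insert m T)"
      using T(1,2) by (auto simp: disjoint_family_on_def B_def)
    moreover have "\<exists>t\<in>insert m T. w u \<le> w t \<and> N u \<inter> N t \<noteq> {}" if "u \<in> A" for u
      using T(3) that max[OF that] by (cases "u \<in> B") (auto simp: B_def)
    ultimately show ?thesis
      using T(1) m(1) by (intro exI[of _ "insert m T"]) (auto simp: B_def)
  qed (auto simp: disjoint_family_on_def)
qed

lemma card_inter_add_card_le:
  assumes "finite N" "X \<subseteq> N" "X \<inter> U = {}"
  shows "card (N \<inter> U) + card X \<le> card N"
proof -
  have "card (N \<inter> U) + card X = card ((N \<inter> U) \<union> X)"
    using assms finite_subset[OF assms(2,1)] by (subst card_Un_disjoint) auto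
  also have "\<dots> \<le> card N" using assms by (intro card_mono) auto
  finally show ?thesis .
qed

text \<open>Weighted double counting bounds \<open>card U\<close> by \<open>D * sum w V\<close>
  minus the \<open>w\<close>-weighted sum of the deficiencies \<open>d\<close>. Each of the disjoint
  sets \<open>N t\<close> contributes at least \<open>2 - 2 * w t\<close> to that sum.\<close>

lemma residual_after_greedy_packing:
  fixes w :: "'a \<Rightarrow> real" and V :: "'a set" and E :: "'a \<Rightarrow> 'a \<Rightarrow> bool"
  defines "N \<equiv> closed_nbhd V E" and "D \<equiv> max_degree V E"
  assumes G: "fin_simple_graph V E" and w: "fractional_dominating V E w"
    and T: "T \<subseteq> {v\<in>V. card (N v) = Suc D}" "disjoint_family_on N T"
    and full: "\<And>u. u \<in> V \<Longrightarrow> card (N u) = Suc D \<Longrightarrow> \<exists>t\<in>T. w u \<le> w t \<and> N u \<inter> N t \<noteq> {}"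
    and U: "U = V - \<Union>(N ` T)"
  shows "\<And>u. u \<in> V \<Longrightarrow> card (N u \<inter> U) \<le> D"
    and "real (card U) \<le> real D * sum w V - 2 * real (card T) + 2 * sum w T"
proof -
  have V: "finite V" using G by (simp add: fin_simple_graph_def)
  have TV: "T \<subseteq> V" using T by auto
  have finT: "finite T" using TV V finite_subset by blast
  have w0: "0 \<le> w v" and w1: "1 \<le> sum w (N v)" if "v \<in> V" for v
    using w that by (auto simp: fractional_dominating_def N_def)
  have fN: "finite (N v)" for v using V by (simp add: N_def finite_closed_nbhd)
  have NV: "N v \<subseteq> V" if "v \<in> V" for v using closed_nbhd_subset[OF that] by (simp add: N_def)
  have cN: "card (N v) \<le> Suc D" if "v \<in> V" for v
    using card_closed_nbhd[OF G, of v] degree_le_max_degree[OF V that, of E]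
    by (simp add: N_def D_def)
  have self: "v \<in> N v" for v by (simp add: N_def)
  show le: "card (N u \<inter> U) \<le> D" if u: "u \<in> V" for u
  proof (cases "card (N u) = Suc D")
    case True
    \<comment> \<open>By maximality of the packing, a closed neighbourhood of full size has already
      lost a point.\<close>
    then obtain t z where "t \<in> T" "z \<in> N u" "z \<in> N t" using full[OF u] by blast
    then show ?thesis using card_inter_add_card_le[of "N u" "{z}" U] fN U True by auto
  next
    case False
    then have "card (N u) \<le> D" using cN[OF u] by simp
    then show ?thesis using card_mono[OF fN, of "N u \<inter> U" u] by simp
  qed
  define d where "d u = real D - real (card (N u \<inter> U))" for u
  have d0: "0 \<le> d u" if "u \<in> V" for u using le[OF that] by (simp add: d_def)
  text \<open>A neighbour heavier than \<open>t\<close> was rejected because of an earlier packing element,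
    which costs it one more vertex.\<close>
  have nb: "2 * w s - w t \<le> w s * d s" if t: "t \<in> T" and s: "s \<in> N t - {t}" for s t
  proof -
    have sV: "s \<in> V" using s t NV TV by blast
    have ts: "{s, t} \<subseteq> N s" using s closed_nbhd_sym[OF G, of s t] self by (auto simp: N_def)
    have stU: "{s, t} \<inter> U = {}" using s t self by (auto simp: U)
    have c2: "card {s, t} = 2" using s by simp
    have "card (N s \<inter> U) + 2 \<le> card (N s)"
      using card_inter_add_card_le[OF fN ts stU] c2 by simp
    then have d1: "1 \<le> d s" using cN[OF sV] by (simp add: d_def)
    show ?thesis
    proof (cases "w s \<le> w t")
      case True
      then show ?thesis using mult_left_mono[OF d1 w0[OF sV]] by simp
    next
      case False
      have "2 \<le> d s"
      proof (cases "card (N s) = Suc D")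
        case True
        then obtain t' where t': "t' \<in> T" "w s \<le> w t'" "N s \<inter> N t' \<noteq> {}"
          using full[OF sV] by blast
        then obtain z where z: "z \<in> N s" "z \<in> N t'" by blast
        have "t' \<noteq> t" using t' False by auto
        then have "N t \<inter> N t' = {}" using T(2) t t'(1) by (auto simp: disjoint_family_on_def)
        then have "z \<noteq> s" "z \<noteq> t" using z s self by auto
        then have "card {z, s, t} = 3" using s by simp
        moreover have "{z, s, t} \<inter> U = {}" using stU z t' by (auto simp: U)
        ultimately have "card (N s \<inter> U) + 3 \<le> card (N s)"
          using card_inter_add_card_le[OF fN, of "{z, s, t}" s U] ts z by simp
        then show ?thesis using cN[OF sV] by (simp add: d_def)
      next
        \<comment> \<open>The vertex by which \<open>N s\<close> falls short of full size stands in
          for a third covered point.\<close>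
        case F: False
        then show ?thesis using \<open>card (N s \<inter> U) + 2 \<le> card (N s)\<close> cN[OF sV] by (simp add: d_def)
      qed
      then have "w s * 2 \<le> w s * d s" by (rule mult_left_mono) (rule w0[OF sV])
      then show ?thesis using w0 t TV by (smt (verit) subsetD)
    qed
  qed
  have star: "2 - 2 * w t \<le> (\<Sum>u\<in>N t. w u * d u)" if t: "t \<in> T" for t
  proof -
    have tV: "t \<in> V" using t TV by auto
    have "N t \<inter> U = {}" using t by (auto simp: U)
    then have dt: "d t = real D" by (simp add: d_def)
    have cs: "card (N t - {t}) = D" using T(1) t self fN by auto
    \<comment> \<open>The \<open>D\<close> deductions of \<open>w t\<close> are cancelled by the
      term of \<open>t\<close> itself, whose deficiency is \<open>D\<close>.\<close>
    have "2 * (sum w (N t) - w t) - real D * w t = (\<Sum>s\<in>N t - {t}. 2 * w s - w t)"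
      using cs fN self[of t] by (simp add: sum_subtractf sum_distrib_left[symmetric] sum_diff1)
    also have "\<dots> \<le> (\<Sum>s\<in>N t - {t}. w s * d s)" by (rule sum_mono) (rule nb[OF t])
    also have "\<dots> = (\<Sum>u\<in>N t. w u * d u) - real D * w t"
      using fN self[of t] dt by (simp add: sum_diff1)
    finally have "2 * (sum w (N t) - w t) \<le> (\<Sum>u\<in>N t. w u * d u)" by simp
    then show ?thesis using w1[OF tV] by argo
  qed
  have "2 * real (card T) - 2 * sum w T = (\<Sum>t\<in>T. 2 - 2 * w t)"
    by (simp add: sum_subtractf sum_distrib_left)
  also have "\<dots> \<le> (\<Sum>t\<in>T. \<Sum>u\<in>N t. w u * d u)" by (rule sum_mono) (rule star)
  also have "\<dots> = (\<Sum>u\<in>\<Union>(N ` T). w u * d u)"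
    using finT fN T(2) by (subst sum.UNION_disjoint) (auto simp: disjoint_family_on_def)
  also have "\<dots> \<le> (\<Sum>u\<in>V. w u * d u)"
    using V NV TV w0 d0 by (intro sum_mono2) (auto intro!: mult_nonneg_nonneg)
  also have "\<dots> = real D * sum w V - (\<Sum>u\<in>V. w u * real (card (N u \<inter> U)))"
    by (simp add: d_def right_diff_distrib sum_subtractf sum_distrib_left mult.commute)
  finally show "real (card U) \<le> real D * sum w V - 2 * real (card T) + 2 * sum w T"
    using card_le_fractional_dominating[OF G w, of U] unfolding U N_def by fastforce
qed

text \<open>Here \<open>T\<close> and \<open>a\<close> are the size and weight of the packing,
  \<open>U\<close> is the number of vertices left and \<open>W\<close> the total weight. The surplus
  \<open>2 * a\<close> in \<open>U1\<close> is repaid because the remaining vertices are covered at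
  the cost of \<open>W - a\<close> only.\<close>

lemma fractional_domination_arithmetic:
  fixes D T U W a h :: real
  assumes D: "3 \<le> D" "0 \<le> (D - 3) * (D - 4)" and h: "11 / 6 \<le> h"
    and a: "0 \<le> a" "a \<le> W"
    and U1: "U \<le> D * W - 2 * T + 2 * a" and U2: "U + (D + 1) * T \<le> (D + 1) * W"
  shows "T + (U / D + (h - 7 / 6) * (W - a)) \<le> h * W"
proof -
  have eq: "T + U / D = (D * T + U) / D" using D(1) by (simp add: field_simps)
  have D0: "0 \<le> D" using D(1) by simp
  have expand: "(h - 7 / 6) * (W - a) = h * W - 7 / 6 * W - (h - 7 / 6) * a"
    by (simp only: right_diff_distrib left_diff_distrib)
  show ?thesis
  \<comment> \<open>At the threshold \<open>U1\<close> without its \<open>2 * a\<close> gives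
    exactly \<open>D * T + U \<le> 7 / 6 * D * W\<close>; above it \<open>U2\<close> takes
    over.\<close>
  proof (cases "6 * (D - 2) * T \<le> D * W")
    case True
    have "D * T + U \<le> 7 / 6 * D * W + 2 * a" using U1 True by (simp add: algebra_simps)
    from divide_right_mono[OF this D0] have "T + U / D \<le> 7 / 6 * W + 2 / D * a"
      unfolding eq using D(1) by (simp add: add_divide_distrib)
    moreover have "2 / D * a \<le> (h - 7 / 6) * a"
    proof (rule mult_right_mono[OF _ a(1)])
      have "2 / D \<le> 2 / 3" using D by (simp add: field_simps)
      then show "2 / D \<le> h - 7 / 6" using h by linarith
    qed
    ultimately show ?thesis unfolding expand by linarith
  next
    case False
    have W: "0 \<le> W" using a by simp
    \<comment> \<open>Expanded, this is the hypothesis on \<open>(D - 3) * (D - 4)\<close>.\<close>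
    have "(6 - D) * (D - 2) \<le> D" using D(2) by (simp add: algebra_simps)
    from mult_right_mono[OF this W] have "(D - 2) * ((6 - D) * W) \<le> (D - 2) * (6 * T)"
      using False by (simp add: algebra_simps)
    then have "(6 - D) * W \<le> 6 * T" using D(1) by simp
    then have "D * T + U \<le> 7 / 6 * D * W" using U2 by (simp add: algebra_simps)
    from divide_right_mono[OF this D0] have "T + U / D \<le> 7 / 6 * W"
      unfolding eq using D(1) by simp
    moreover have "0 \<le> (h - 7 / 6) * a" using h a by simp
    ultimately show ?thesis unfolding expand by linarith
  qed
qed

text \<open>The packing \<open>T\<close> exhausts the closed neighbourhoods of full size, so the
  greedy phases can start at \<open>D\<close>. They use only vertices outside \<open>T\<close>,
  hence only the weight \<open>sum w V - sum w T\<close>.\<close>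

lemma domination_number_le_large_degree:
  assumes G: "fin_simple_graph V E" and w: "fractional_dominating V E w"
    and D3: "3 \<le> max_degree V E"
  shows "real (domination_number V E) \<le> harm (max_degree V E) * sum w V"
proof -
  define N where "N = closed_nbhd V E"
  define D where "D = max_degree V E"
  have V: "finite V" using G by (simp add: fin_simple_graph_def)
  have w0: "0 \<le> w v" and w1: "1 \<le> sum w (N v)" if "v \<in> V" for v
    using w that by (auto simp: fractional_dominating_def N_def)
  have fN: "finite (N v)" for v using V by (simp add: N_def finite_closed_nbhd)
  have NV: "N v \<subseteq> V" if "v \<in> V" for v using closed_nbhd_subset[OF that] by (simp add: N_def)
  have cN: "card (N v) \<le> Suc D" if "v \<in> V" for v
    using card_closed_nbhd[OF G, of v] degree_le_max_degree[OF V that, of E]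
    by (simp add: N_def D_def)
  have self: "v \<in> N v" for v by (simp add: N_def)
  have "\<exists>T\<subseteq>{v\<in>V. card (N v) = Suc D}. disjoint_family_on N T \<and>
    (\<forall>u\<in>{v\<in>V. card (N v) = Suc D}. \<exists>t\<in>T. w u \<le> w t \<and> N u \<inter> N t \<noteq> {})"
    by (rule greedy_packing) (use V self in auto)
  then obtain T where T: "T \<subseteq> {v\<in>V. card (N v) = Suc D}" "disjoint_family_on N T"
    and full: "\<And>u. u \<in> V \<Longrightarrow> card (N u) = Suc D \<Longrightarrow> \<exists>t\<in>T. w u \<le> w t \<and> N u \<inter> N t \<noteq> {}"
    by auto
  have TV: "T \<subseteq> V" using T by auto
  have finT: "finite T" using TV V finite_subset by blast
  define U where "U = V - \<Union>(N ` T)"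
  have UV: "U \<subseteq> V" by (auto simp: U_def)
  have fU: "finite U" using V by (simp add: U_def)
  note res = residual_after_greedy_packing[OF G w, folded N_def D_def, OF T full U_def]
  have sW: "sum w V = sum w (V - T) + sum w T" using V TV by (simp add: sum.subset_diff)
  have "\<exists>S\<subseteq>V - T. U \<subseteq> \<Union>(N ` S) \<and>
    real (card S) \<le> real (card U) / real D + (harm D - 7 / 6) * sum w (V - T)"
  proof (rule set_cover_harm)
    fix u assume u: "u \<in> U"
    \<comment> \<open>A vertex outside every \<open>N t\<close> has no \<open>t\<close> in its own
      closed neighbourhood, so leaving out \<open>T\<close> loses no covering weight.\<close>
    have "{i\<in>V - T. u \<in> N i} = N u"
      using closed_nbhd_converse[OF G, of u] u by (auto simp: U_def N_def)
    then show "1 \<le> sum w {i\<in>V - T. u \<in> N i}" using w1 u UV by auto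
  qed (use V w0 D3 fU res(1) in \<open>auto simp: D_def\<close>)
  then obtain S where S: "S \<subseteq> V - T" "U \<subseteq> \<Union>(N ` S)"
    "real (card S) \<le> real (card U) / real D + (harm D - 7 / 6) * sum w (V - T)" by blast
  have "dominating_set V E (T \<union> S)"
    unfolding dominating_set_iff_closed_nbhd[OF G] using TV S by (auto simp: U_def N_def)
  then have "domination_number V E \<le> card (T \<union> S)" by (rule domination_number_le)
  also have "\<dots> \<le> card T + card S" by (rule card_Un_le)
  finally have dom: "real (domination_number V E) \<le> real (card T) + real (card S)" by linarith
  have cT: "card (\<Union>(N ` T)) = Suc D * card T"
  proof -
    have "card (\<Union>(N ` T)) = (\<Sum>t\<in>T. card (N t))"
      using finT fN T(2) by (intro card_UN_disjoint) (auto simp: disjoint_family_on_def)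
    also have "\<dots> = (\<Sum>t\<in>T. Suc D)" using T(1) by (intro sum.cong) auto
    finally show ?thesis by simp
  qed
  have sub: "\<Union>(N ` T) \<subseteq> V" using NV TV by auto
  have "card U + Suc D * card T = card V"
    using cT card_Diff_subset[OF finite_subset[OF sub V] sub] card_mono[OF V sub]
    by (simp add: U_def)
  moreover have "real (card V) \<le> (\<Sum>u\<in>V. w u * real (card (N u \<inter> V)))"
    unfolding N_def by (rule card_le_fractional_dominating[OF G w]) simp
  moreover have "\<dots> \<le> (\<Sum>u\<in>V. w u * (real D + 1))"
  proof (intro sum_mono mult_left_mono w0)
    fix u assume u: "u \<in> V"
    then have "N u \<inter> V = N u" using NV by auto
    then show "real (card (N u \<inter> V)) \<le> real D + 1" using cN[OF u] by simp
  qed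
  moreover have "\<dots> = (real D + 1) * sum w V"
    by (metis sum_distrib_right mult.commute)
  ultimately have U2: "real (card U) + (real D + 1) * real (card T) \<le> (real D + 1) * sum w V"
    by (smt (verit) of_nat_add of_nat_mult of_nat_Suc)
  have h: "11 / 6 \<le> (harm D :: real)"
  proof -
    have "harm 3 = (11 / 6 :: real)" by (simp add: harm_def numeral_3_eq_3)
    then show ?thesis using harm_mono[of 3 D, where ?'a = real] D3 by (simp add: D_def)
  qed
  \<comment> \<open>Integrality of the degree enters here: no natural number lies strictly between 3
    and 4.\<close>
  have "0 \<le> (real D - 3) * (real D - 4)"
    using D3 by (cases "D = 3") (auto simp: D_def intro!: mult_nonneg_nonneg)
  then have "real (card T) + (real (card U) / real D + (harm D - 7 / 6) * (sum w V - sum w T))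
      \<le> harm D * sum w V"
    using D3 h U2 res(2) w0 TV V
    by (intro fractional_domination_arithmetic) (auto simp: D_def intro!: sum_nonneg sum_mono2)
  then show ?thesis using dom S(3) sW by (simp add: D_def)
qed

lemma domination_number_le_harm:
  assumes G: "fin_simple_graph V E" and w: "fractional_dominating V E w"
    and D: "1 \<le> max_degree V E"
  shows "real (domination_number V E) \<le> harm (max_degree V E) * sum w V"
proof -
  consider "max_degree V E = 1" | "max_degree V E = 2" | "3 \<le> max_degree V E"
    using D by linarith
  then show ?thesis
  proof cases
    case 1
    then show ?thesis using domination_number_le_small_degree[OF assms] by (simp add: harm_def)
  next
    case 2
    have harm2: "harm 2 = (3 / 2 :: real)" by (simp add: harm_def numeral_2_eq_2)
    show ?thesis
      using domination_number_le_small_degree[OF assms] unfolding 2 harm2 by simp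
  next
    case 3
    then show ?thesis by (rule domination_number_le_large_degree[OF G w])
  qed
qed

section \<open>Covers\<close>

text \<open>There are no loops below, so \<open>p y\<close> differs from the images of the
  neighbours of \<open>y\<close>.\<close>

lemma covering_map_inj_on_closed_nbhd:
  assumes F: "fin_simple_graph VF EF" and p: "covering_map VG EG VF EF p" and y: "y \<in> VG"
  shows "inj_on p (closed_nbhd VG EG y)"
proof -
  have b: "bij_betw p (nbrs VG EG y) (nbrs VF EF (p y))"
    using p y by (simp add: covering_map_def)
  have "p y \<notin> nbrs VF EF (p y)" using F by (simp add: nbrs_def fin_simple_graph_def)
  then have "p y \<notin> p ` nbrs VG EG y" using b by (simp add: bij_betw_def)
  then show ?thesis using b by (auto simp: closed_nbhd_def bij_betw_def)
qed

lemma covering_map_closed_nbhd: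
  assumes p: "covering_map VG EG VF EF p" and y: "y \<in> VG" and x: "x \<in> closed_nbhd VG EG y"
  shows "p x \<in> closed_nbhd VF EF (p y)"
proof -
  have "p ` nbrs VG EG y = nbrs VF EF (p y)"
    using p y by (simp add: covering_map_def bij_betw_def)
  then show ?thesis using x by (auto simp: closed_nbhd_def)
qed

text \<open>Each vertex of the fibre over \<open>v\<close> picks a dominator in \<open>S\<close>.
  Injectivity on closed neighbourhoods makes these \<open>k\<close> dominators distinct, and all of
  them lie above the closed neighbourhood of \<open>v\<close>.\<close>

lemma fractional_dominating_fibre_density:
  assumes F: "fin_simple_graph VF EF" and G: "fin_simple_graph VG EG"
    and p: "covering_map VG EG VF EF p"
    and k: "\<And>u. u \<in> VF \<Longrightarrow> card {v\<in>VG. p v = u} = k" "0 < k"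
    and S: "dominating_set VG EG S"
  shows "fractional_dominating VF EF (\<lambda>u. real (card {v\<in>S. p v = u}) / real k)"
    and "(\<Sum>u\<in>VF. real (card {v\<in>S. p v = u}) / real k) = real (card S) / real k"
proof -
  have VF: "finite VF" and VG: "finite VG" using F G by (auto simp: fin_simple_graph_def)
  have SV: "S \<subseteq> VG" and SN: "VG \<subseteq> \<Union>(closed_nbhd VG EG ` S)"
    using S dominating_set_iff_closed_nbhd[OF G] by auto
  have fS: "finite S" using SV VG finite_subset by blast
  have fibres: "(\<Sum>u\<in>B. card {v\<in>S. p v = u}) = card {v\<in>S. p v \<in> B}" if "finite B" for B
  proof -
    have "{v\<in>S. p v \<in> B} = (\<Union>u\<in>B. {v\<in>S. p v = u})" by auto
    then show ?thesis using that fS by (simp, subst card_UN_disjoint) auto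
  qed
  have "1 \<le> (\<Sum>u\<in>closed_nbhd VF EF v. real (card {x\<in>S. p x = u}) / real k)" if v: "v \<in> VF" for v
  proof -
    let ?B = "closed_nbhd VF EF v"
    have "\<forall>x\<in>{x\<in>VG. p x = v}. \<exists>y. y \<in> S \<and> x \<in> closed_nbhd VG EG y" using SN by auto
    then obtain g where g: "\<And>x. x \<in> VG \<Longrightarrow> p x = v \<Longrightarrow> g x \<in> S \<and> x \<in> closed_nbhd VG EG (g x)"
      by (metis (mono_tags, lifting) mem_Collect_eq)
    have "inj_on g {x\<in>VG. p x = v}"
    proof (rule inj_onI)
      fix x x' assume "x \<in> {x\<in>VG. p x = v}" "x' \<in> {x\<in>VG. p x = v}" "g x = g x'"
      then show "x = x'"
        using g[of x] g[of x'] SV covering_map_inj_on_closed_nbhd[OF F p, of "g x"]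
        by (auto simp: inj_on_def)
    qed
    moreover have "g ` {x\<in>VG. p x = v} \<subseteq> {x\<in>S. p x \<in> ?B}"
    proof
      fix y assume "y \<in> g ` {x\<in>VG. p x = v}"
      then obtain x where x: "x \<in> VG" "p x = v" "y = g x" by auto
      then have "y \<in> S" "x \<in> closed_nbhd VG EG y" using g by auto
      then have "p x \<in> closed_nbhd VF EF (p y)" using covering_map_closed_nbhd[OF p] SV by auto
      then show "y \<in> {x\<in>S. p x \<in> ?B}" using \<open>y \<in> S\<close> x closed_nbhd_sym[OF F] by auto
    qed
    ultimately have "card {x\<in>VG. p x = v} \<le> card {x\<in>S. p x \<in> ?B}"
      using fS by (intro card_inj_on_le) auto
    then have "k \<le> (\<Sum>u\<in>?B. card {x\<in>S. p x = u})"
      using k(1)[OF v] fibres finite_closed_nbhd[OF VF] by simp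
    then have "real k \<le> (\<Sum>u\<in>?B. real (card {x\<in>S. p x = u}))" by (simp flip: of_nat_sum)
    then show ?thesis using k(2) by (simp flip: sum_divide_distrib)
  qed
  then show "fractional_dominating VF EF (\<lambda>u. real (card {v\<in>S. p v = u}) / real k)"
    by (simp add: fractional_dominating_def)
  have "{v\<in>S. p v \<in> VF} = S" using p SV by (auto simp: covering_map_def)
  then show "(\<Sum>u\<in>VF. real (card {v\<in>S. p v = u}) / real k) = real (card S) / real k"
    using fibres[OF VF] by (simp flip: sum_divide_distrib of_nat_sum)
qed

theorem theorem2p4:
  fixes VF :: "'b set" and EF :: "'b \<Rightarrow> 'b \<Rightarrow> bool"
    and VG :: "'a set" and EG :: "'a \<Rightarrow> 'a \<Rightarrow> bool" and k :: nat
  assumes "fin_simple_graph VF EF"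
    and "fin_simple_graph VG EG"
    and "max_degree VF EF \<ge> 1"
    and "k_fold_cover k VG EG VF EF"
  shows "real (domination_number VG EG)
           \<ge> (1 / harm (max_degree VF EF)) * real k * real (domination_number VF EF)"
proof (cases "k = 0")
  \<comment> \<open>Fibre densities require division by \<open>k\<close>. For \<open>k = 0\<close>
    the bound is trivial and is left to the closing \<open>simp\<close>.\<close>
  case False
  obtain p where p: "covering_map VG EG VF EF p"
    and k: "\<And>u. u \<in> VF \<Longrightarrow> card {v\<in>VG. p v = u} = k"
    using assms(4) by (auto simp: k_fold_cover_def)
  obtain S where S: "dominating_set VG EG S" "card S = domination_number VG EG"
    by (rule domination_number_attained)
  have h: "0 < (harm (max_degree VF EF) :: real)"
    using assms(3) by (intro harm_pos) simp
  have k0: "0 < k" using False by simp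
  have fd: "fractional_dominating VF EF (\<lambda>u. real (card {v\<in>S. p v = u}) / real k)"
    "(\<Sum>u\<in>VF. real (card {v\<in>S. p v = u}) / real k) = real (card S) / real k"
    by (rule fractional_dominating_fibre_density[OF assms(1,2) p k k0 S(1)]; assumption)+
  have "real (domination_number VF EF)
      \<le> harm (max_degree VF EF) * (real (domination_number VG EG) / real k)"
    using domination_number_le_harm[OF assms(1) fd(1) assms(3)] unfolding fd(2) S(2) .
  then show ?thesis using h k0 by (simp add: field_simps)
qed simp

end
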